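(* Let $n>k$ be positive integers, let $X$ be a real $n\times k$ matrix with $\mathrm{rank}(X)=k$, let $\Omega$ be a real symmetric positive definite $n\times n$ matrix, and let $K_1,K_2$ be given real symmetric positive semidefinite $k\times k$ matrices. Then $$\hat{\beta}(\Omega,K_1)=\hat{\beta}(I_n,K_2)\quad\text{for every } y\in\mathbb{R}^n$$ holds if and only if there exists a real $k\times k$ matrix $G$ such that $$X=\Omega X G\quad\text{and}\quad K_1=K_2G.$$
   Context: For a symmetric positive definite $n\times n$ matrix $\Phi$ and a symmetric positive semidefinite $k\times k$ matrix $K$, the general ridge estimator based on the observation $y\in\mathbb{R}^n$ is $$\hat{\beta}(\Phi,K)=(X^\top\Phi^{-1}X+K)^{-1}X^\top\Phi^{-1}y .$$ $I_n$ is the $n\times n$ identity matrix. *)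

theory Defs
  imports "HOL-Analysis.Analysis"
begin

definition sym_pos_def :: "real^'n^'n \<Rightarrow> bool" where
  "sym_pos_def A \<longleftrightarrow> transpose A = A \<and> (\<forall>v. v \<noteq> 0 \<longrightarrow> 0 < v \<bullet> (A *v v))"

definition sym_pos_semidef :: "real^'n^'n \<Rightarrow> bool" where
  "sym_pos_semidef A \<longleftrightarrow> transpose A = A \<and> (\<forall>v. 0 \<le> v \<bullet> (A *v v))"

text \<open>
  The type \<open>real^'k^'n\<close> is that of matrices with \<open>CARD('n)\<close> rows and
  \<open>CARD('k)\<close> columns. \<open>matrix_inv\<close> is unspecified on singular matrices; when \<open>X\<close> has full column
  rank, \<open>\<Phi>\<close> is positive definite and \<open>K\<close> is positive semidefinite, both matrices inverted here
  are positive definite and hence invertible.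
\<close>
definition ridge_estimator ::
    "real^'k^'n \<Rightarrow> real^'n^'n \<Rightarrow> real^'k^'k \<Rightarrow> real^'n \<Rightarrow> real^'k" where
  "ridge_estimator X \<Phi> K y =
     (matrix_inv (transpose X ** matrix_inv \<Phi> ** X + K)
        ** transpose X ** matrix_inv \<Phi>) *v y"

end

theory Submission
  imports Defs
begin

text \<open>
  Put \<open>P = \<Omega>\<inverse>\<close>, \<open>A = X\<^sup>T P X + K1\<close> and \<open>B = X\<^sup>T X + K2\<close>. The estimators agree for every \<open>y\<close>
  exactly when the matrices \<open>A\<inverse> X\<^sup>T P\<close> and \<open>B\<inverse> X\<^sup>T\<close> are equal. Transposing, which fixes the
  symmetric matrices \<open>A\<inverse>\<close>, \<open>B\<inverse>\<close> and \<open>P\<close>, and cancelling \<open>A\<inverse>\<close> on the right turns this into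
  \<open>P X = X G\<close> with \<open>G = B\<inverse> A\<close>, that is, \<open>X = \<Omega> X G\<close> and \<open>A = B G\<close>.

  This is the only \<open>G\<close> that can occur in the criterion: as soon as \<open>P X = X G\<close> holds, the summands
  \<open>X\<^sup>T P X\<close> of \<open>A\<close> and \<open>X\<^sup>T X G\<close> of \<open>B G\<close> coincide, so that \<open>K1 = K2 G\<close> is equivalent to \<open>A = B G\<close>,
  which determines \<open>G\<close> as \<open>B\<inverse> A\<close>.

  Definiteness and the rank condition enter by making \<open>A\<close>, \<open>B\<close> and \<open>\<Omega>\<close> invertible
  (\<open>sym_pos_def_invertible\<close>, \<open>sym_pos_def_normal_matrix\<close>); the rest is matrix algebra.
\<close>

lemma matrix_inv_mult:
  fixes A :: "real^'n^'n"
  assumes "invertible A"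
  shows matrix_mult_inv_right: "A ** matrix_inv A = mat 1"
    and matrix_mult_inv_left: "matrix_inv A ** A = mat 1"
proof -
  have "A ** matrix_inv A = mat 1 \<and> matrix_inv A ** A = mat 1"
    using assms unfolding invertible_def matrix_inv_def by (rule someI_ex)
  then show "A ** matrix_inv A = mat 1" "matrix_inv A ** A = mat 1"
    by simp_all
qed

lemma matrix_mult_eq_iff_inv_left:
  fixes A :: "real^'n^'n" and B C :: "real^'m^'n"
  assumes "invertible A"
  shows "C = A ** B \<longleftrightarrow> matrix_inv A ** C = B"
  using matrix_inv_mult[OF assms] by (metis matrix_mul_assoc matrix_mul_lid)

lemma matrix_mult_eq_iff_inv_right:
  fixes A :: "real^'n^'n" and B C :: "real^'n^'m"
  assumes "invertible A"
  shows "C ** matrix_inv A = B \<longleftrightarrow> C = B ** A"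
  using matrix_inv_mult[OF assms] by (metis matrix_mul_assoc matrix_mul_rid)

lemma matrix_add_mult_distrib:
  fixes A B :: "real^'n^'m" and C :: "real^'p^'n"
  shows "(A + B) ** C = A ** C + B ** C"
  by (simp add: matrix_eq matrix_vector_mult_add_rdistrib flip: matrix_vector_mul_assoc)

lemma transpose_add: "transpose (A + B) = transpose A + transpose B"
  by (simp add: transpose_def vec_eq_iff)

lemma inner_transpose_mult:
  fixes A :: "real^'m^'n"
  shows "v \<bullet> (transpose A *v w) = (A *v v) \<bullet> w"
  by (metis dot_lmul_matrix inner_commute transpose_matrix_vector)

lemma transpose_matrix_inv_symmetric:
  fixes A :: "real^'n^'n"
  assumes "invertible A" and "transpose A = A"
  shows "transpose (matrix_inv A) = matrix_inv A"
proof -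
  have "transpose (matrix_inv A) ** A = mat 1"
    by (metis assms matrix_mult_inv_right matrix_transpose_mul transpose_mat)
  then show ?thesis
    by (metis assms(1) matrix_mul_lid matrix_mult_eq_iff_inv_right)
qed

lemma sym_pos_def_invertible:
  assumes "sym_pos_def A"
  shows "invertible A"
proof -
  \<comment> \<open>A kernel vector \<open>v\<close> would give \<open>v \<bullet> (A *v v) = 0\<close>.\<close>
  have "v = 0" if "A *v v = 0" for v
    using assms that unfolding sym_pos_def_def by (metis inner_zero_right less_irrefl)
  then show ?thesis
    using invertible_left_inverse matrix_left_invertible_ker by blast
qed

lemma sym_pos_def_mat_1: "sym_pos_def (mat 1)"
  by (simp add: sym_pos_def_def)

text \<open>Substituting \<open>v = A *v w\<close> turns the quadratic form of \<open>A\<inverse>\<close> at \<open>v\<close> into that of \<open>A\<close> at \<open>w\<close>.\<close>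
lemma sym_pos_def_matrix_inv:
  assumes "sym_pos_def A"
  shows "sym_pos_def (matrix_inv A)"
  unfolding sym_pos_def_def
proof (intro conjI allI impI)
  have inv: "invertible A"
    using assms by (rule sym_pos_def_invertible)
  show "transpose (matrix_inv A) = matrix_inv A"
    using assms inv by (simp add: sym_pos_def_def transpose_matrix_inv_symmetric)
  fix v :: "real^'a"
  assume "v \<noteq> 0"
  define w where "w = matrix_inv A *v v"
  have v: "v = A *v w"
    by (simp add: w_def matrix_vector_mul_assoc matrix_mult_inv_right[OF inv])
  then have "w \<noteq> 0"
    using \<open>v \<noteq> 0\<close> by auto
  then have "0 < w \<bullet> (A *v w)"
    using assms by (simp add: sym_pos_def_def)
  then show "0 < v \<bullet> (matrix_inv A *v v)"
    by (metis inner_commute v w_def)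
qed

text \<open>
  The quadratic form of \<open>X\<^sup>T P X\<close> at \<open>v\<close> is that of \<open>P\<close> at \<open>X *v v\<close>, which vanishes only for \<open>v = 0\<close>
  because \<open>X\<close> has full column rank; adding a positive semidefinite matrix keeps it positive.
\<close>
lemma sym_pos_def_normal_matrix:
  fixes X :: "real^'k^'n"
  assumes "rank X = CARD('k)" and P: "sym_pos_def P" and K: "sym_pos_semidef K"
  shows "sym_pos_def (transpose X ** P ** X + K)"
  unfolding sym_pos_def_def
proof (intro conjI allI impI)
  show "transpose (transpose X ** P ** X + K) = transpose X ** P ** X + K"
    using P K
    by (simp add: sym_pos_def_def sym_pos_semidef_def transpose_add matrix_transpose_mul
        matrix_mul_assoc)
  fix v :: "real^'k"
  assume "v \<noteq> 0"
  have "inj ((*v) X)"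
    using assms(1) by (simp add: full_rank_injective)
  then have "X *v v \<noteq> 0"
    using \<open>v \<noteq> 0\<close> by (metis injD matrix_vector_mult_0_right)
  then have "0 < (X *v v) \<bullet> (P *v (X *v v))"
    using P by (simp add: sym_pos_def_def)
  moreover have "0 \<le> v \<bullet> (K *v v)"
    using K by (simp add: sym_pos_semidef_def)
  ultimately show "0 < v \<bullet> ((transpose X ** P ** X + K) *v v)"
    by (simp add: matrix_vector_mult_add_rdistrib inner_add_right inner_transpose_mult
        del: transpose_matrix_vector flip: matrix_vector_mul_assoc)
qed

theorem theorem3p1:
  fixes X :: "real^'k^'n"
    and \<Omega> :: "real^'n^'n"
    and K1 K2 :: "real^'k^'k"
  assumes "CARD('k) < CARD('n)"
    and "rank X = CARD('k)"
    and "sym_pos_def \<Omega>"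
    and "sym_pos_semidef K1"
    and "sym_pos_semidef K2"
  shows "(\<forall>y. ridge_estimator X \<Omega> K1 y = ridge_estimator X (mat 1) K2 y) \<longleftrightarrow>
         (\<exists>G :: real^'k^'k. X = \<Omega> ** X ** G \<and> K1 = K2 ** G)"
proof -
  define P where "P = matrix_inv \<Omega>"
  define A where "A = transpose X ** P ** X + K1"
  define B where "B = transpose X ** X + K2"
  have inv_id: "matrix_inv (mat 1 :: real^'n^'n) = mat 1"
    using matrix_mult_inv_left[OF sym_pos_def_invertible[OF sym_pos_def_mat_1]] by simp
  have inv_Omega: "invertible \<Omega>"
    using assms(3) by (rule sym_pos_def_invertible)
  have pd_P: "sym_pos_def P"
    unfolding P_def using assms(3) by (rule sym_pos_def_matrix_inv)
  have pd_A: "sym_pos_def A"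
    unfolding A_def using assms(2) pd_P assms(4) by (rule sym_pos_def_normal_matrix)
  have pd_B: "sym_pos_def B"
    unfolding B_def
    using sym_pos_def_normal_matrix[OF assms(2) sym_pos_def_mat_1 assms(5)] by simp
  note inv_A = sym_pos_def_invertible[OF pd_A] and inv_B = sym_pos_def_invertible[OF pd_B]
  have symm: "transpose P = P" "transpose (matrix_inv A) = matrix_inv A"
      "transpose (matrix_inv B) = matrix_inv B"
    using pd_P sym_pos_def_matrix_inv[OF pd_A] sym_pos_def_matrix_inv[OF pd_B]
    by (simp_all add: sym_pos_def_def)

  have "(\<forall>y. ridge_estimator X \<Omega> K1 y = ridge_estimator X (mat 1) K2 y) \<longleftrightarrow>
      matrix_inv A ** transpose X ** P = matrix_inv B ** transpose X"
    by (simp add: ridge_estimator_def inv_id A_def B_def P_def matrix_eq)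
  also have "\<dots> \<longleftrightarrow> transpose (matrix_inv A ** transpose X ** P) =
      transpose (matrix_inv B ** transpose X)"
    by (metis transpose_transpose)
  also have "\<dots> \<longleftrightarrow> P ** X ** matrix_inv A = X ** matrix_inv B"
    by (simp add: matrix_transpose_mul symm matrix_mul_assoc)
  also have "\<dots> \<longleftrightarrow> P ** X = X ** (matrix_inv B ** A)"
    by (simp add: matrix_mult_eq_iff_inv_right[OF inv_A] matrix_mul_assoc)
  also have "\<dots> \<longleftrightarrow> (\<exists>G. P ** X = X ** G \<and> A = B ** G)"
    using matrix_mult_eq_iff_inv_left[OF inv_B] by metis
  also have "\<dots> \<longleftrightarrow> (\<exists>G. X = \<Omega> ** X ** G \<and> K1 = K2 ** G)"
  proof -
    have "A = B ** G \<longleftrightarrow> K1 = K2 ** G" if "P ** X = X ** G" for G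
    proof -
      have "A = transpose X ** X ** G + K1"
        by (metis A_def matrix_mul_assoc that)
      then show ?thesis
        by (simp add: B_def matrix_add_mult_distrib)
    qed
    moreover have "X = \<Omega> ** X ** G \<longleftrightarrow> P ** X = X ** G" for G
      using matrix_mult_eq_iff_inv_left[OF inv_Omega, of X "X ** G"]
      by (simp add: P_def matrix_mul_assoc)
    ultimately show ?thesis
      by blast
  qed
  finally show ?thesis .
qed

end
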